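(* Let $0<r<1$, let $\theta$ be a measure preserving transformation of a probability space $(X,\Sigma,\mu)$, let $Tf=f\circ\theta$ be the induced operator on $L^r(\mu)$, and let $f\in L^r(\mu)$. (i) If $f\in (I-T)L^r(\mu)$, then $\int\big|\frac1n\sum_{k=0}^{n-1}T^kf\big|^r d\mu\to 0$ as $n\to\infty$. (ii) If $\int\big|\frac1n\sum_{k=0}^{n-1}T^kf\big|^r d\mu\to 0$ as $n\to\infty$, then $f\in\overline{(I-T)L^r(\mu)}$, the closure being taken in the $L^r$ metric.
   Context: For $0<r<1$, $L^r(\mu)=\{f \text{ measurable}:\int|f|^r d\mu<\infty\}$ (modulo a.e. equality) is a vector space with the complete invariant metric $d(f,g)=\int|f-g|^r d\mu$, called the $L^r$ metric. $(I-T)L^r(\mu)=\{g-Tg: g\in L^r(\mu)\}$. *)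

theory Defs
  imports "HOL-Probability.Probability"
begin

text \<open>
  Elements of \<open>L\<^sup>r(\<mu>)\<close> are represented by functions; two functions represent the same element
  iff they agree almost everywhere. The scalar type is any \<open>real_normed_field\<close>. Its norm
  is multiplicative, so such a field is \<open>\<real>\<close> or \<open>\<complex>\<close> (Gelfand--Mazur): both choices of scalars are
  covered, and the additional sort \<open>second_countable_topology\<close> is no restriction.
\<close>

definition Lr_space :: "'a measure \<Rightarrow> real \<Rightarrow> ('a \<Rightarrow> 'b::{real_normed_field, second_countable_topology}) set"
  where "Lr_space M r =
    {f \<in> borel_measurable M. integrable M (\<lambda>x. norm (f x) powr r)}"

definition Lr_dist :: "'a measure \<Rightarrow> real \<Rightarrow> ('a \<Rightarrow> 'b::{real_normed_field, second_countable_topology}) \<Rightarrow> ('a \<Rightarrow> 'b) \<Rightarrow> real"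
  where "Lr_dist M r f g = (\<integral>x. norm (f x - g x) powr r \<partial>M)"

text \<open>
  The topology of the \<open>L\<^sup>r\<close> metric, pulled back to representatives. The library's
  \<open>Metric_space.mtopology\<close> does not apply directly, since \<open>Lr_dist\<close> vanishes for functions that
  are merely equal almost everywhere.
\<close>

definition Lr_topology :: "'a measure \<Rightarrow> real \<Rightarrow> ('a \<Rightarrow> 'b::{real_normed_field, second_countable_topology}) topology"
  where "Lr_topology M r = topology (\<lambda>U. U \<subseteq> Lr_space M r \<and>
    (\<forall>f\<in>U. \<exists>\<epsilon>>0. \<forall>g\<in>Lr_space M r. Lr_dist M r f g < \<epsilon> \<longrightarrow> g \<in> U))"

definition measure_preserving_map :: "'a measure \<Rightarrow> ('a \<Rightarrow> 'a) \<Rightarrow> bool"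
  where "measure_preserving_map M \<theta> \<longleftrightarrow> \<theta> \<in> measurable M M \<and>
    (\<forall>A\<in>sets M. emeasure M (\<theta> -` A \<inter> space M) = emeasure M A)"

definition koopman :: "('a \<Rightarrow> 'a) \<Rightarrow> ('a \<Rightarrow> 'b) \<Rightarrow> ('a \<Rightarrow> 'b)"
  where "koopman \<theta> f = f \<circ> \<theta>"

definition ergodic_average :: "('a \<Rightarrow> 'a) \<Rightarrow> nat \<Rightarrow> ('a \<Rightarrow> 'b::real_normed_field) \<Rightarrow> ('a \<Rightarrow> 'b)"
  where "ergodic_average \<theta> n f = (\<lambda>x. 1 / of_nat n * (\<Sum>k<n. (koopman \<theta> ^^ k) f x))"

text \<open>The subspace \<open>(I - T) L\<^sup>r(\<mu>)\<close>, closed under a.e. equality of representatives.\<close>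

definition I_minus_T_Lr :: "'a measure \<Rightarrow> real \<Rightarrow> ('a \<Rightarrow> 'a) \<Rightarrow> ('a \<Rightarrow> 'b::{real_normed_field, second_countable_topology}) set"
  where "I_minus_T_Lr M r \<theta> =
    {f \<in> Lr_space M r. \<exists>g\<in>Lr_space M r. AE x in M. f x = g x - koopman \<theta> g x}"


lemma powr_add_le:
  fixes a b r :: real
  assumes "0 < r" "r < 1" "0 \<le> a" "0 \<le> b"
  shows "(a + b) powr r \<le> a powr r + b powr r"
proof (cases "a + b = 0")
  case True
  then show ?thesis using assms by simp
next
  case False
  then have s: "a + b > 0" using assms by simp
  have le: "t / (a + b) * (a + b) powr r \<le> t powr r" if "0 \<le> t" "t \<le> a + b" for t
  proof -
    have "t / (a + b) \<le> (t / (a + b)) powr r"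
    proof (cases "t = 0")
      case False
      then show ?thesis
        using powr_mono'[of r 1 "t / (a + b)"] that s assms by simp
    qed simp
    also have "\<dots> = t powr r / (a + b) powr r"
      using that s by (simp add: powr_divide)
    finally show ?thesis using s by (simp add: field_simps)
  qed
  have "(a + b) powr r = a / (a + b) * (a + b) powr r + b / (a + b) * (a + b) powr r"
    using s by (simp add: add_divide_distrib [symmetric] distrib_right [symmetric])
  also have "\<dots> \<le> a powr r + b powr r"
    using le[of a] le[of b] assms by simp
  finally show ?thesis .
qed

lemma norm_powr_add_le:
  fixes a b :: "'b::real_normed_field"
  assumes "0 < r" "r < 1"
  shows "norm (a + b) powr r \<le> norm a powr r + norm b powr r"
  using powr_add_le[OF assms, of "norm a" "norm b"] 
    powr_mono2[of r "norm (a + b)" "norm a + norm b"] norm_triangle_ineq[of a b] assms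
  by simp

lemma Lr_space_measurable [measurable_dest]: "f \<in> Lr_space M r \<Longrightarrow> f \<in> borel_measurable M"
  by (simp add: Lr_space_def)

lemma Lr_space_add:
  assumes "0 < r" "r < 1" and f: "f \<in> Lr_space M r" and g: "g \<in> Lr_space M r"
  shows "(\<lambda>x. f x + g x) \<in> Lr_space M r"
proof -
  have [measurable]: "f \<in> borel_measurable M" "g \<in> borel_measurable M"
    using f g by (auto simp: Lr_space_def)
  have "integrable M (\<lambda>x. norm (f x + g x) powr r)"
  proof (rule Bochner_Integration.integrable_bound)
    show "integrable M (\<lambda>x. norm (f x) powr r + norm (g x) powr r)"
      using f g by (auto simp: Lr_space_def)
  qed (auto simp: norm_powr_add_le[OF assms(1,2)])
  then show ?thesis by (simp add: Lr_space_def)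
qed

lemma Lr_space_cmult:
  assumes "f \<in> Lr_space M r"
  shows "(\<lambda>x. c * f x) \<in> Lr_space M r"
  using assms by (auto simp: Lr_space_def norm_mult powr_mult)

lemma Lr_space_diff:
  assumes "0 < r" "r < 1" "f \<in> Lr_space M r" "g \<in> Lr_space M r"
  shows "(\<lambda>x. f x - g x) \<in> Lr_space M r"
  using Lr_space_add[OF assms(1-3) Lr_space_cmult[OF assms(4), of "-1"]] by simp

lemma Lr_space_sum:
  assumes "0 < r" "r < 1" "finite I" "\<And>i. i \<in> I \<Longrightarrow> f i \<in> Lr_space M r"
  shows "(\<lambda>x. \<Sum>i\<in>I. f i x) \<in> Lr_space M r"
  using assms(3,4)
proof (induction I rule: finite_induct)
  case empty
  then show ?case using assms by (simp add: Lr_space_def)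
next
  case (insert i I)
  then show ?case using Lr_space_add[OF assms(1,2), of "f i" M "\<lambda>x. \<Sum>i\<in>I. f i x"] by simp
qed

lemma measure_preserving_map_distr:
  assumes "measure_preserving_map M \<theta>"
  shows "distr M M \<theta> = M"
  using assms by (intro measure_eqI) (auto simp: measure_preserving_map_def emeasure_distr)

lemma Lr_space_koopman:
  assumes \<theta>: "measure_preserving_map M \<theta>" and f: "f \<in> Lr_space M r"
  shows "koopman \<theta> f \<in> Lr_space M r"
proof -
  have m [measurable]: "\<theta> \<in> measurable M M" "f \<in> borel_measurable M"
    using \<theta> f by (auto simp: measure_preserving_map_def Lr_space_def)
  have "integrable (distr M M \<theta>) (\<lambda>x. norm (f x) powr r)"
    using f by (simp add: Lr_space_def measure_preserving_map_distr[OF \<theta>])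
  then have "integrable M (\<lambda>x. norm (f (\<theta> x)) powr r)"
    by (subst (asm) integrable_distr_eq) auto
  then show ?thesis by (simp add: Lr_space_def koopman_def comp_def)
qed

lemma Lr_space_koopman_power:
  "measure_preserving_map M \<theta> \<Longrightarrow> f \<in> Lr_space M r \<Longrightarrow> (koopman \<theta> ^^ k) f \<in> Lr_space M r"
  by (induction k) (auto intro: Lr_space_koopman)

text \<open>
  Hence the Bochner integrals of the \<open>r\<close>-th powers of ergodic averages are integrals of integrable
  functions and do not take the default value \<open>0\<close>.
\<close>

lemma Lr_space_ergodic_average:
  assumes "0 < r" "r < 1" "measure_preserving_map M \<theta>" "f \<in> Lr_space M r"
  shows "ergodic_average \<theta> n f \<in> Lr_space M r"
  unfolding ergodic_average_def
  by (intro Lr_space_cmult Lr_space_sum Lr_space_koopman_power assms finite_lessThan)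

lemma Lr_dist_commute: "Lr_dist M r f g = Lr_dist M r g f"
  by (simp add: Lr_dist_def norm_minus_commute)

lemma Lr_dist_eq_0_iff:
  assumes "0 < r" "r < 1" "f \<in> Lr_space M r" "g \<in> Lr_space M r"
  shows "Lr_dist M r f g = 0 \<longleftrightarrow> (AE x in M. f x = g x)"
proof -
  have "integrable M (\<lambda>x. norm (f x - g x) powr r)"
    using Lr_space_diff[OF assms] by (simp add: Lr_space_def)
  then show ?thesis
    unfolding Lr_dist_def by (subst integral_nonneg_eq_0_iff_AE) auto
qed

lemma Lr_dist_triangle:
  assumes r: "0 < r" "r < 1"
    and f: "f \<in> Lr_space M r" and g: "g \<in> Lr_space M r" and h: "h \<in> Lr_space M r"
  shows "Lr_dist M r f h \<le> Lr_dist M r f g + Lr_dist M r g h"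
proof -
  have i: "integrable M (\<lambda>x. norm (u x - v x) powr r)" 
    if "u \<in> Lr_space M r" "v \<in> Lr_space M r" for u v :: "_ \<Rightarrow> 'b"
    using Lr_space_diff[OF r that] by (simp add: Lr_space_def)
  have "Lr_dist M r f h \<le> (\<integral>x. norm (f x - g x) powr r + norm (g x - h x) powr r \<partial>M)"
    unfolding Lr_dist_def
  proof (rule integral_mono)
    show "norm (f x - h x) powr r \<le> norm (f x - g x) powr r + norm (g x - h x) powr r" for x
      using norm_powr_add_le[OF r, of "f x - g x" "g x - h x"] by simp
  qed (rule i[OF f h], rule Bochner_Integration.integrable_add[OF i[OF f g] i[OF g h]])
  also have "\<dots> = Lr_dist M r f g + Lr_dist M r g h"
    unfolding Lr_dist_def by (rule Bochner_Integration.integral_add) (auto intro: i f g h)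
  finally show ?thesis .
qed

lemma openin_Lr_topology:
  "openin (Lr_topology M r) U \<longleftrightarrow> U \<subseteq> Lr_space M r \<and>
    (\<forall>f\<in>U. \<exists>\<epsilon>>0. \<forall>g\<in>Lr_space M r. Lr_dist M r f g < \<epsilon> \<longrightarrow> g \<in> U)"
proof -
  have "istopology (\<lambda>U. U \<subseteq> Lr_space M r \<and>
    (\<forall>f\<in>U. \<exists>\<epsilon>>0. \<forall>g\<in>Lr_space M r. Lr_dist M r f g < \<epsilon> \<longrightarrow> g \<in> U))" (is "istopology ?P")
    unfolding istopology_def
  proof (intro conjI allI impI)
    fix S T assume S: "?P S" and T: "?P T"
    show "S \<inter> T \<subseteq> Lr_space M r" using S by blast
    show "\<forall>f\<in>S \<inter> T. \<exists>\<epsilon>>0. \<forall>g\<in>Lr_space M r. Lr_dist M r f g < \<epsilon> \<longrightarrow> g \<in> S \<inter> T"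
    proof
      fix f assume f: "f \<in> S \<inter> T"
      obtain a where "a > 0" "\<forall>g\<in>Lr_space M r. Lr_dist M r f g < a \<longrightarrow> g \<in> S" 
        using S f by blast
      moreover obtain b where "b > 0" "\<forall>g\<in>Lr_space M r. Lr_dist M r f g < b \<longrightarrow> g \<in> T" 
        using T f by blast
      ultimately show "\<exists>\<epsilon>>0. \<forall>g\<in>Lr_space M r. Lr_dist M r f g < \<epsilon> \<longrightarrow> g \<in> S \<inter> T"
        by (intro exI[of _ "min a b"]) auto
    qed
  next
    fix \<K> assume K: "\<forall>K\<in>\<K>. ?P K"
    show "\<Union>\<K> \<subseteq> Lr_space M r" using K by blast
    show "\<forall>f\<in>\<Union>\<K>. \<exists>\<epsilon>>0. \<forall>g\<in>Lr_space M r. Lr_dist M r f g < \<epsilon> \<longrightarrow> g \<in> \<Union>\<K>"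
      using K by (meson Union_iff)
  qed
  then show ?thesis
    unfolding Lr_topology_def by (simp only: topology_inverse'[OF \<open>istopology _\<close>])
qed

lemma topspace_Lr_topology [simp]: "topspace (Lr_topology M r) = Lr_space M r"
proof (rule antisym)
  show "topspace (Lr_topology M r) \<subseteq> Lr_space M r"
    using openin_topspace[of "Lr_topology M r"] unfolding openin_Lr_topology by blast
  show "Lr_space M r \<subseteq> topspace (Lr_topology M r)"
    by (rule openin_subset) (auto simp: openin_Lr_topology intro: exI[of _ 1])
qed

lemma Lr_closure_of:
  assumes r: "0 < r" "r < 1" and S: "S \<subseteq> Lr_space M r"
  shows "Lr_topology M r closure_of S =
    {f \<in> Lr_space M r. \<forall>\<epsilon>>0. \<exists>g\<in>S. Lr_dist M r f g < \<epsilon>}" (is "?L = ?R")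
proof (intro equalityI subsetI)
  fix f assume f: "f \<in> ?L"
  then have fL: "f \<in> Lr_space M r" by (simp add: in_closure_of)
  have "\<exists>g\<in>S. Lr_dist M r f g < \<epsilon>" if "\<epsilon> > 0" for \<epsilon>
  proof -
    let ?B = "{g \<in> Lr_space M r. Lr_dist M r f g < \<epsilon>}"
    have "\<exists>\<delta>>0. \<forall>h\<in>Lr_space M r. Lr_dist M r g h < \<delta> \<longrightarrow> h \<in> ?B" if g: "g \<in> ?B" for g
    proof (intro exI[of _ "\<epsilon> - Lr_dist M r f g"] conjI ballI impI)
      show "0 < \<epsilon> - Lr_dist M r f g" using g by simp
      fix h assume h: "h \<in> Lr_space M r" "Lr_dist M r g h < \<epsilon> - Lr_dist M r f g"
      have "Lr_dist M r f h \<le> Lr_dist M r f g + Lr_dist M r g h"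
        using Lr_dist_triangle[OF r fL _ h(1)] g by simp
      then show "h \<in> ?B" using h by simp
    qed
    then have "openin (Lr_topology M r) ?B" by (auto simp: openin_Lr_topology)
    moreover have "f \<in> ?B" using fL r that by (simp add: Lr_dist_def)
    moreover have "\<forall>T. f \<in> T \<and> openin (Lr_topology M r) T \<longrightarrow> (\<exists>y. y \<in> S \<and> y \<in> T)"
      using f unfolding in_closure_of by (rule conjunct2)
    ultimately have "\<exists>y. y \<in> S \<and> y \<in> ?B" by (meson allE)
    then show ?thesis by auto
  qed
  then show "f \<in> ?R" using fL by simp
next
  fix f assume f: "f \<in> ?R"
  have "\<exists>y\<in>S. y \<in> T" if "f \<in> T" "openin (Lr_topology M r) T" for T
    using that f S unfolding openin_Lr_topology by (smt (verit) mem_Collect_eq subsetD)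
  then show "f \<in> ?L" using f by (auto simp: in_closure_of)
qed

end

theory Submission
  imports Defs
begin

text \<open>
  Both halves rest on telescoping. If \<open>f = g - T g\<close>, then the sum of the first \<open>n\<close> iterates of \<open>f\<close>
  collapses to \<open>g - T\<^sup>n g\<close>. For \<open>r < 1\<close> the integral of the \<open>r\<close>-th power of the norm is subadditive
  but homogeneous only of degree \<open>r\<close>; as \<open>T\<close> preserves it, the average has integral at most
  \<open>2 n\<^sup>-\<^sup>r \<integral>|g|\<^sup>r\<close>, which tends to \<open>0\<close>.

  Conversely, the polynomial identity
  \<open>1 - (1 + T + \<dots> + T\<^sup>n\<^sup>-\<^sup>1) / n = (1 - T) (\<Sum>k<n. \<Sum>j<k. T\<^sup>j) / n\<close> shows that \<open>f - A\<^sub>n f\<close>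
  lies in \<open>(I - T) L\<^sup>r\<close> for every \<open>f\<close> in \<open>L\<^sup>r\<close> and every \<open>n > 0\<close>, where \<open>A\<^sub>n f\<close> is the ergodic average. Its
  distance from \<open>f\<close> is exactly \<open>\<integral>|A\<^sub>n f|\<^sup>r\<close>, so if these integrals tend to \<open>0\<close>, then \<open>f\<close> lies in
  the closure.
\<close>

lemma koopman_apply: "koopman \<theta> f x = f (\<theta> x)"
  by (simp add: koopman_def)

lemma koopman_power_apply: "(koopman \<theta> ^^ k) f x = f ((\<theta> ^^ k) x)"
  by (induction k arbitrary: x) (simp_all add: koopman_apply funpow_swap1[of \<theta>])

lemma AE_measure_preserving_power:
  assumes \<theta>: "measure_preserving_map M \<theta>" and P: "AE x in M. P x"
  shows "AE x in M. P ((\<theta> ^^ k) x)"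
proof (induction k)
  case (Suc k)
  have "\<theta> \<in> measurable M M"
    using \<theta> by (simp add: measure_preserving_map_def)
  moreover have "AE x in distr M M \<theta>. P ((\<theta> ^^ k) x)"
    unfolding measure_preserving_map_distr[OF \<theta>] by (rule Suc.IH)
  ultimately have "AE x in M. P ((\<theta> ^^ k) (\<theta> x))"
    by (rule AE_distrD)
  then show ?case
    by (simp add: funpow_swap1)
qed (use P in simp)

lemma integral_norm_powr_koopman_power:
  fixes g :: "'a \<Rightarrow> 'b::{real_normed_field, second_countable_topology}"
  assumes \<theta>: "measure_preserving_map M \<theta>" and g: "g \<in> Lr_space M r"
  shows "(\<integral>x. norm ((koopman \<theta> ^^ k) g x) powr r \<partial>M) = (\<integral>x. norm (g x) powr r \<partial>M)"
proof (induction k)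
  case (Suc k)
  let ?u = "(koopman \<theta> ^^ k) g"
  have [measurable]: "\<theta> \<in> measurable M M" "?u \<in> borel_measurable M"
    using \<theta> Lr_space_koopman_power[OF \<theta> g]
    by (auto simp: measure_preserving_map_def Lr_space_def)
  have "(\<integral>x. norm (?u (\<theta> x)) powr r \<partial>M) = (\<integral>x. norm (?u x) powr r \<partial>distr M M \<theta>)"
    by (subst integral_distr) auto
  then show ?case
    using Suc.IH by (simp add: measure_preserving_map_distr[OF \<theta>] koopman_apply[of \<theta> ?u])
qed simp

text \<open>
  The equation for \<open>f\<close> holds only almost everywhere, but telescoping uses it along the whole orbit of
  a point. The exceptional points are those whose orbit meets a fixed null set: a countable union of
  preimages of that null set, and \<open>\<theta>\<close> pulls null sets back to null sets.
\<close>

lemma AE_ergodic_average_coboundary: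
  fixes f g :: "'a \<Rightarrow> 'b::real_normed_field"
  assumes \<theta>: "measure_preserving_map M \<theta>"
    and fg: "AE x in M. f x = g x - koopman \<theta> g x"
  shows "AE x in M. ergodic_average \<theta> n f x = 1 / of_nat n * (g x - (koopman \<theta> ^^ n) g x)"
proof -
  have "AE x in M. \<forall>k. f ((\<theta> ^^ k) x) = g ((\<theta> ^^ k) x) - koopman \<theta> g ((\<theta> ^^ k) x)"
    using AE_measure_preserving_power[OF \<theta> fg] by (simp add: AE_all_countable)
  then show ?thesis
  proof eventually_elim
    case (elim x)
    have "(\<Sum>k<n. f ((\<theta> ^^ k) x)) = (\<Sum>k<n. g ((\<theta> ^^ k) x) - g ((\<theta> ^^ Suc k) x))"
      using elim by (simp add: koopman_def)
    also have "\<dots> = g x - g ((\<theta> ^^ n) x)"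
      by (subst sum_lessThan_telescope') simp
    finally show ?case
      by (simp add: ergodic_average_def koopman_power_apply)
  qed
qed

text \<open>
  The factor \<open>1 / n\<close> leaves the integral as \<open>n\<^sup>-\<^sup>r\<close>, which still decays because \<open>r > 0\<close>. The
  two boundary terms \<open>g\<close> and \<open>T\<^sup>n g\<close> of the telescoped sum contribute equally, whatever \<open>n\<close> is,
  since \<open>T\<close> preserves the integral.
\<close>

lemma integral_ergodic_average_coboundary_le:
  fixes f g :: "'a \<Rightarrow> 'b::{real_normed_field, second_countable_topology}"
  assumes r: "0 < r" "r < 1" and \<theta>: "measure_preserving_map M \<theta>"
    and f: "f \<in> Lr_space M r" and g: "g \<in> Lr_space M r"
    and fg: "AE x in M. f x = g x - koopman \<theta> g x"
  shows "(\<integral>x. norm (ergodic_average \<theta> n f x) powr r \<partial>M)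
    \<le> (1 / real n) powr r * (2 * (\<integral>x. norm (g x) powr r \<partial>M))"
proof -
  let ?h = "(koopman \<theta> ^^ n) g"
  have h: "?h \<in> Lr_space M r"
    by (rule Lr_space_koopman_power[OF \<theta> g])
  have int: "integrable M (\<lambda>x. norm (g x) powr r)" "integrable M (\<lambda>x. norm (?h x) powr r)"
    using g h by (simp_all add: Lr_space_def)
  have "AE x in M. norm (ergodic_average \<theta> n f x) powr r
      \<le> (1 / real n) powr r * (norm (g x) powr r + norm (?h x) powr r)"
    using AE_ergodic_average_coboundary[OF \<theta> fg, of n]
  proof eventually_elim
    case (elim x)
    have "norm (ergodic_average \<theta> n f x) powr r
        = (1 / real n) powr r * norm (g x - ?h x) powr r"
      unfolding elim by (simp add: norm_mult norm_divide powr_mult powr_divide)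
    moreover have "norm (g x - ?h x) powr r \<le> norm (g x) powr r + norm (?h x) powr r"
      using norm_powr_add_le[OF r, of "g x" "- ?h x"] by simp
    ultimately show ?case
      by (simp add: mult_left_mono)
  qed
  then have "(\<integral>x. norm (ergodic_average \<theta> n f x) powr r \<partial>M)
      \<le> (\<integral>x. (1 / real n) powr r * (norm (g x) powr r + norm (?h x) powr r) \<partial>M)"
    using Lr_space_ergodic_average[OF r \<theta> f, of n] int
    by (intro integral_mono_AE) (auto simp: Lr_space_def)
  also have "\<dots> = (1 / real n) powr r * (2 * (\<integral>x. norm (g x) powr r \<partial>M))"
    using int integral_norm_powr_koopman_power[OF \<theta> g, of n] by simp
  finally show ?thesis .
qed

lemma minus_koopman_power_coboundary:
  fixes f :: "'a \<Rightarrow> 'b::real_normed_field" and \<theta> :: "'a \<Rightarrow> 'a"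
  defines "s \<equiv> \<lambda>k x. \<Sum>j<k. (koopman \<theta> ^^ j) f x"
  shows "f x - (koopman \<theta> ^^ k) f x = s k x - s k (\<theta> x)"
proof -
  have "s k x - s k (\<theta> x) = (\<Sum>j<k. f ((\<theta> ^^ j) x) - f ((\<theta> ^^ Suc j) x))"
    by (simp add: s_def koopman_power_apply sum_subtractf funpow_swap1)
  also have "\<dots> = f x - (koopman \<theta> ^^ k) f x"
    by (subst sum_lessThan_telescope') (simp add: koopman_power_apply)
  finally show ?thesis ..
qed

text \<open>
  Averaging the coboundaries \<open>f - T\<^sup>k f\<close> over \<open>k < n\<close> gives \<open>f - A\<^sub>n f\<close>. Positivity of \<open>n\<close> matters:
  for \<open>n = 0\<close> the average is \<open>0\<close> and the claim would say that \<open>f\<close> itself is a coboundary.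
\<close>

lemma minus_ergodic_average_in_I_minus_T_Lr:
  fixes f :: "'a \<Rightarrow> 'b::{real_normed_field, second_countable_topology}"
  assumes r: "0 < r" "r < 1" and \<theta>: "measure_preserving_map M \<theta>"
    and f: "f \<in> Lr_space M r" and n: "0 < n"
  shows "(\<lambda>x. f x - ergodic_average \<theta> n f x) \<in> I_minus_T_Lr M r \<theta>"
proof -
  define s where "s = (\<lambda>k x. \<Sum>j<k. (koopman \<theta> ^^ j) f x)"
  define h where "h = (\<lambda>x. 1 / of_nat n * (\<Sum>k<n. s k x))"
  have "h \<in> Lr_space M r"
    unfolding h_def s_def
    by (intro Lr_space_cmult Lr_space_sum Lr_space_koopman_power r \<theta> f finite_lessThan)
  moreover have "f x - ergodic_average \<theta> n f x = h x - koopman \<theta> h x" for x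
  proof -
    have "f x - ergodic_average \<theta> n f x = 1 / of_nat n * (\<Sum>k<n. f x - (koopman \<theta> ^^ k) f x)"
      using n by (simp add: ergodic_average_def sum_subtractf right_diff_distrib diff_divide_distrib)
    also have "\<dots> = 1 / of_nat n * (\<Sum>k<n. s k x - s k (\<theta> x))"
      unfolding s_def by (simp only: minus_koopman_power_coboundary)
    also have "\<dots> = h x - koopman \<theta> h x"
      by (simp add: h_def koopman_def sum_subtractf diff_divide_distrib)
    finally show ?thesis .
  qed
  ultimately show ?thesis
    using Lr_space_diff[OF r f Lr_space_ergodic_average[OF r \<theta> f, of n]]
    unfolding I_minus_T_Lr_def by blast
qed

theorem theorem2p3:
  fixes M :: "'a measure" and \<theta> :: "'a \<Rightarrow> 'a" and r :: real
    and f :: "'a \<Rightarrow> 'b::{real_normed_field, second_countable_topology}"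
  assumes "0 < r" and "r < 1"
    and "prob_space M"
    and "measure_preserving_map M \<theta>"
    and "f \<in> Lr_space M r"
  shows "(f \<in> I_minus_T_Lr M r \<theta> \<longrightarrow>
            (\<lambda>n. \<integral>x. norm (ergodic_average \<theta> n f x) powr r \<partial>M) \<longlonglongrightarrow> 0) \<and>
         ((\<lambda>n. \<integral>x. norm (ergodic_average \<theta> n f x) powr r \<partial>M) \<longlonglongrightarrow> 0 \<longrightarrow>
            f \<in> Lr_topology M r closure_of I_minus_T_Lr M r \<theta>)"
proof (intro conjI impI)
  note r = assms(1,2) and \<theta> = assms(4) and f = assms(5)
  {
    assume "f \<in> I_minus_T_Lr M r \<theta>"
    then obtain g where g: "g \<in> Lr_space M r" and fg: "AE x in M. f x = g x - koopman \<theta> g x"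
      by (auto simp: I_minus_T_Lr_def)
    have "(\<lambda>n. (1 / real n) powr r) \<longlonglongrightarrow> 0"
      using r by (auto intro!: tendsto_zero_powrI lim_1_over_n)
    then have "(\<lambda>n. (1 / real n) powr r * (2 * (\<integral>x. norm (g x) powr r \<partial>M))) \<longlonglongrightarrow> 0"
      by (rule tendsto_mult_left_zero)
    then show "(\<lambda>n. \<integral>x. norm (ergodic_average \<theta> n f x) powr r \<partial>M) \<longlonglongrightarrow> 0"
      by (rule tendsto_sandwich[OF _ _ tendsto_const, rotated 2])
        (simp_all add: integral_ergodic_average_coboundary_le[OF r \<theta> f g fg])
  next
    assume lim: "(\<lambda>n. \<integral>x. norm (ergodic_average \<theta> n f x) powr r \<partial>M) \<longlonglongrightarrow> 0"
    have "\<exists>g\<in>I_minus_T_Lr M r \<theta>. Lr_dist M r f g < \<epsilon>" if "\<epsilon> > 0" for \<epsilon>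
    proof -
      have "\<forall>\<^sub>F n in sequentially. 0 < n \<and> (\<integral>x. norm (ergodic_average \<theta> n f x) powr r \<partial>M) < \<epsilon>"
        using eventually_gt_at_top[of 0] order_tendstoD(2)[OF lim that] by (rule eventually_conj)
      then obtain n where n: "0 < n" "(\<integral>x. norm (ergodic_average \<theta> n f x) powr r \<partial>M) < \<epsilon>"
        by (auto simp: eventually_sequentially)
      then have "Lr_dist M r f (\<lambda>x. f x - ergodic_average \<theta> n f x) < \<epsilon>"
        by (simp add: Lr_dist_def)
      with minus_ergodic_average_in_I_minus_T_Lr[OF r \<theta> f n(1)] show ?thesis
        by blast
    qed
    moreover have "I_minus_T_Lr M r \<theta> \<subseteq> (Lr_space M r :: ('a \<Rightarrow> 'b) set)"
      by (auto simp: I_minus_T_Lr_def)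
    ultimately show "f \<in> Lr_topology M r closure_of I_minus_T_Lr M r \<theta>"
      using f by (simp add: Lr_closure_of[OF r])
  }
qed

end
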